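(* We have $$C_{1324,2431}(x)=P(x)\cdot\sum_{k\ge 0}\mathrm{steep}(k)\,x^k,$$ where $\mathrm{steep}(k)$ is the number of steep partitions of $k$ and $P(x)=\sum_{k\ge0}p(k)x^k$ is the generating function of the integer partition numbers $p(k)$.
   Context: An integer partition $\lambda$ is called steep if the difference between any two consecutive distinct part sizes of $\lambda$ (positive parts only) is greater than or equal to the multiplicity of the smaller of the two. (For example $(5,5,3,3,2,1)$ is steep, but $(3,2,2)$ and $(5,3,3,3,1)$ are not; the empty partition is steep.) $\mathrm{av}_n^k(B)$ is the number of permutations in $S_n$ with exactly $k$ inversions (pairs $i<j$ with $\pi_i>\pi_j$) that avoid every pattern in $B$; a permutation avoids a pattern $q$ if it has no subsequence order-isomorphic to $q$. If for every $k\ge0$ there are constants $m_k,c_k(B)$ with $\mathrm{av}_n^k(B)=c_k(B)$ for all $n\ge m_k$, then $(c_k(B))_{k\ge0}$ is the limit sequence of $B$ and $C_B(x)=\sum_{k\ge 0}c_k(B)x^k$ is its limit generating function; here $B=\{1324,2431\}$. *)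

theory Defs
  imports
    "HOL-Computational_Algebra.Formal_Power_Series"
    "HOL-Combinatorics.Multiset_Permutations"
    "HOL-Library.Sublist"
begin

text \<open>Permutations in \<open>S\<^sub>n\<close> are written in one-line notation, as the lists in
  \<open>permutations_of_set {1..n}\<close>. Patterns are lists as well.\<close>

definition inversions :: "nat list \<Rightarrow> (nat \<times> nat) set" where
  "inversions xs = {(i, j). i < j \<and> j < length xs \<and> xs ! i > xs ! j}"

definition order_isomorphic :: "nat list \<Rightarrow> nat list \<Rightarrow> bool" where
  "order_isomorphic xs ys \<longleftrightarrow> length xs = length ys \<and>
     (\<forall>i < length xs. \<forall>j < length xs. xs ! i < xs ! j \<longleftrightarrow> ys ! i < ys ! j)"

definition avoids :: "nat list \<Rightarrow> nat list \<Rightarrow> bool" where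
  "avoids xs q \<longleftrightarrow> \<not> (\<exists>ys. subseq ys xs \<and> order_isomorphic ys q)"

definition av :: "nat list set \<Rightarrow> nat \<Rightarrow> nat \<Rightarrow> nat" where
  "av B n k = card {xs \<in> permutations_of_set {1..n}.
     card (inversions xs) = k \<and> (\<forall>q\<in>B. avoids xs q)}"

definition has_limit_sequence :: "nat list set \<Rightarrow> bool" where
  "has_limit_sequence B \<longleftrightarrow> (\<forall>k. \<exists>m c. \<forall>n\<ge>m. av B n k = c)"

text \<open>Only meaningful if \<open>has_limit_sequence B\<close> holds; the eventual value is then unique.\<close>

definition limit_sequence :: "nat list set \<Rightarrow> nat \<Rightarrow> nat" where
  "limit_sequence B k = (THE c. \<exists>m. \<forall>n\<ge>m. av B n k = c)"

definition limit_gf :: "nat list set \<Rightarrow> nat fps" where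
  "limit_gf B = Abs_fps (limit_sequence B)"

text \<open>Integer partitions of \<open>k\<close> are finite multisets of positive numbers with sum \<open>k\<close>.\<close>

definition partitions :: "nat \<Rightarrow> nat multiset set" where
  "partitions k = {p. 0 \<notin># p \<and> sum_mset p = k}"

text \<open>The parts \<open>a < b\<close> are consecutive distinct part sizes. Neither the gap between \<open>0\<close> and
  the smallest part nor the multiplicity of the largest part is constrained.\<close>

definition steep :: "nat multiset \<Rightarrow> bool" where
  "steep p \<longleftrightarrow> (\<forall>a b. a \<in># p \<and> b \<in># p \<and> a < b \<and> \<not> (\<exists>c. c \<in># p \<and> a < c \<and> c < b)
     \<longrightarrow> b - a \<ge> count p a)"

definition partition_gf :: "nat fps" where
  "partition_gf = Abs_fps (\<lambda>k. card (partitions k))"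

definition steep_gf :: "nat fps" where
  "steep_gf = Abs_fps (\<lambda>k. card {p \<in> partitions k. steep p})"

end

theory Submission imports Defs begin

text \<open>
  A permutation of \<open>n \<ge> 2k + 2\<close> elements with \<open>k\<close> inversions has cuts (positions \<open>s\<close> whose
  prefix is a permutation of \<open>{1..s}\<close>) near both of its ends. If it avoids 1324, then \<open>k + 1\<close> is a
  cut too, so the permutation is a direct sum. The sum avoids 1324 and 2431 iff its first summand
  avoids 132 and its second one avoids 213 and 2431. This makes the generating function a product,
  and since reverse-complement exchanges 132 and 213, only 213-avoiders have to be counted.

  Record for each value the number of smaller entries to its right; these numbers sum to the number
  of inversions. A permutation avoids 213 iff they are weakly increasing in the value, that is,
  iff they form a partition padded with zeros, and then it avoids 2431 iff this partition is steep.
\<close>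

section \<open>Subsequences and pattern avoidance\<close>

lemma subseq_rev: "subseq xs ys \<Longrightarrow> subseq (rev xs) (rev ys)"
  by (induction rule: list_emb.induct) (auto intro: list_emb_append_mono)

text \<open>As a rewrite rule this unrolls the splits of an explicit list one by one. The next three
  lemmas use it to list the cases by how many letters fall into \<open>p\<close>.\<close>

lemma ex_append_Cons:
  "(\<exists>us vs. x # xs = us @ vs \<and> P us vs) \<longleftrightarrow>
     P [] (x # xs) \<or> (\<exists>us vs. xs = us @ vs \<and> P (x # us) vs)"
  by (metis Cons_eq_append_conv append_Cons append_Nil)

lemma subseq2_append:
  "subseq [a, b] (p @ q) \<longleftrightarrow>
     subseq [a, b] p \<or> a \<in> set p \<and> b \<in> set q \<or> subseq [a, b] q"
  by (simp only: subseq_append_iff ex_append_Cons) (auto simp: subseq_singleton_left)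

lemma subseq3_append:
  "subseq [a, b, c] (p @ q) \<longleftrightarrow>
     subseq [a, b, c] p \<or> subseq [a, b] p \<and> c \<in> set q \<or>
     a \<in> set p \<and> subseq [b, c] q \<or> subseq [a, b, c] q"
  by (simp only: subseq_append_iff ex_append_Cons) (auto simp: subseq_singleton_left)

lemma subseq4_append:
  "subseq [a, b, c, d] (p @ q) \<longleftrightarrow>
     subseq [a, b, c, d] p \<or> subseq [a, b, c] p \<and> d \<in> set q \<or>
     subseq [a, b] p \<and> subseq [c, d] q \<or>
     a \<in> set p \<and> subseq [b, c, d] q \<or> subseq [a, b, c, d] q"
  by (simp only: subseq_append_iff ex_append_Cons) (auto simp: subseq_singleton_left)

lemma subseq_in_set: "subseq xs ys \<Longrightarrow> x \<in> set xs \<Longrightarrow> x \<in> set ys"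
  by (induction rule: list_emb.induct) auto

lemma avoids_subseq: "avoids xs q \<Longrightarrow> subseq ys xs \<Longrightarrow> avoids ys q"
  unfolding avoids_def using subseq_order.trans by blast

lemma avoids_pattern3:
  "avoids xs [p, q, r] \<longleftrightarrow>
     (\<forall>a b c. subseq [a, b, c] xs \<longrightarrow> \<not> order_isomorphic [a, b, c] [p, q, r])"
proof -
  have "order_isomorphic ys [p, q, r] \<Longrightarrow> \<exists>a b c. ys = [a, b, c]" for ys
    by (simp add: order_isomorphic_def length_Suc_conv) blast
  then show ?thesis unfolding avoids_def by metis
qed

lemma avoids_pattern4:
  "avoids xs [p, q, r, s] \<longleftrightarrow>
     (\<forall>a b c d. subseq [a, b, c, d] xs \<longrightarrow> \<not> order_isomorphic [a, b, c, d] [p, q, r, s])"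
proof -
  have "order_isomorphic ys [p, q, r, s] \<Longrightarrow> \<exists>a b c d. ys = [a, b, c, d]" for ys
    by (simp add: order_isomorphic_def length_Suc_conv) blast
  then show ?thesis unfolding avoids_def by metis
qed

text \<open>With the letters listed in order of value, the comparisons of neighbours imply all
  others by transitivity, so each of the four patterns becomes a chain of strict
  inequalities.\<close>

lemma avoids_132:
  "avoids xs [1,3,2] \<longleftrightarrow> (\<forall>a b c. subseq [a, b, c] xs \<longrightarrow> \<not> (a < c \<and> c < b))"
proof -
  have "order_isomorphic [a, b, c] [1,3,2] \<longleftrightarrow> a < c \<and> c < b" for a b c
    unfolding order_isomorphic_def by (simp add: All_less_Suc2) fastforce
  then show ?thesis by (simp only: avoids_pattern3)
qed

lemma avoids_213:
  "avoids xs [2,1,3] \<longleftrightarrow> (\<forall>a b c. subseq [a, b, c] xs \<longrightarrow> \<not> (b < a \<and> a < c))"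
proof -
  have "order_isomorphic [a, b, c] [2,1,3] \<longleftrightarrow> b < a \<and> a < c" for a b c
    unfolding order_isomorphic_def by (simp add: All_less_Suc2) fastforce
  then show ?thesis by (simp only: avoids_pattern3)
qed

lemma avoids_1324:
  "avoids xs [1,3,2,4] \<longleftrightarrow>
     (\<forall>a b c d. subseq [a, b, c, d] xs \<longrightarrow> \<not> (a < c \<and> c < b \<and> b < d))"
proof -
  have "order_isomorphic [a, b, c, d] [1,3,2,4] \<longleftrightarrow> a < c \<and> c < b \<and> b < d" for a b c d
    unfolding order_isomorphic_def by (simp add: All_less_Suc2) fastforce
  then show ?thesis by (simp only: avoids_pattern4)
qed

lemma avoids_2431:
  "avoids xs [2,4,3,1] \<longleftrightarrow>
     (\<forall>a b c d. subseq [a, b, c, d] xs \<longrightarrow> \<not> (d < a \<and> a < c \<and> c < b))"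
proof -
  have "order_isomorphic [a, b, c, d] [2,4,3,1] \<longleftrightarrow> d < a \<and> a < c \<and> c < b" for a b c d
    unfolding order_isomorphic_def by (simp add: All_less_Suc2) fastforce
  then show ?thesis by (simp only: avoids_pattern4)
qed

lemma order_isomorphic_map:
  assumes "\<And>x y. f x < f y \<longleftrightarrow> x < y"
  shows "order_isomorphic (map f xs) q \<longleftrightarrow> order_isomorphic xs q"
  using assms by (auto simp: order_isomorphic_def)

text \<open>The subsequences of a mapped list are the images of subsequences, and \<open>f\<close>
  preserves their order type. Direct sums need this for shifted entries.\<close>

lemma avoids_map:
  assumes "\<And>x y. f x < f y \<longleftrightarrow> x < y"
  shows "avoids (map f xs) q \<longleftrightarrow> avoids xs q"
proof -
  have "subseq ys (map f xs) \<longleftrightarrow> (\<exists>zs. subseq zs xs \<and> ys = map f zs)" for ys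
    by (auto simp: subseq_conv_nths nths_map)
  then show ?thesis
    using order_isomorphic_map[OF assms] by (auto simp: avoids_def)
qed

section \<open>Counting inversions recursively\<close>

fun num_inv :: "nat list \<Rightarrow> nat" where
  "num_inv [] = 0"
| "num_inv (x # xs) = length (filter (\<lambda>y. y < x) xs) + num_inv xs"

lemma card_inversions: "card (inversions xs) = num_inv xs"
proof (induction xs)
  case (Cons x xs)
  \<comment> \<open>\<open>?A\<close> holds the inversions that start at the head; all others come
    from the tail by shifting both indices, which gives \<open>?B\<close>.\<close>
  let ?A = "(\<lambda>j. (0::nat, Suc j)) ` {j. j < length xs \<and> xs ! j < x}"
  let ?B = "map_prod Suc Suc ` inversions xs"
  have eq: "inversions (x # xs) = ?A \<union> ?B"
  proof (intro set_eqI iffI)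
    fix z assume "z \<in> inversions (x # xs)"
    then obtain i j where z: "z = (i, Suc j)" "i < Suc j" "j < length xs" "(x # xs) ! i > xs ! j"
      by (auto simp: inversions_def less_Suc_eq_0_disj)
    then show "z \<in> ?A \<union> ?B"
      by (cases i) (auto simp: inversions_def image_iff)
  qed (auto simp: inversions_def)
  have "finite (inversions xs)"
    by (rule finite_subset[of _ "{..<length xs} \<times> {..<length xs}"]) (auto simp: inversions_def)
  then have "card (inversions (x # xs)) = card ?A + card ?B"
    unfolding eq by (subst card_Un_disjoint) auto
  also have "\<dots> = num_inv (x # xs)"
    by (simp add: card_image inj_on_def map_prod_def length_filter_conv_card split_beta
        prod_eq_iff flip: Cons.IH)
  finally show ?case .
qed (simp add: inversions_def)

lemma num_inv_append_less:
  "\<forall>x\<in>set xs. \<forall>y\<in>set ys. x < y \<Longrightarrow> num_inv (xs @ ys) = num_inv xs + num_inv ys"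
  by (induction xs) (auto simp: filter_empty_conv)

lemma num_inv_snoc: "num_inv (xs @ [x]) = num_inv xs + length (filter (\<lambda>y. x < y) xs)"
  by (induction xs) auto

lemma num_inv_map: "(\<And>x y. f x < f y \<longleftrightarrow> x < y) \<Longrightarrow> num_inv (map f xs) = num_inv xs"
  by (induction xs) (auto simp: filter_map o_def)

text \<open>No entry of \<open>p\<close> exceeds \<open>N\<close>, and \<open>N\<close> forms an
  inversion with each entry of \<open>q\<close>.\<close>

lemma num_inv_insert_max:
  "\<forall>x\<in>set (p @ q). x < N \<Longrightarrow> num_inv (p @ N # q) = num_inv (p @ q) + length q"
proof (induction p)
  case Nil
  then have "filter (\<lambda>y. y < N) q = q" by (auto simp: filter_id_conv)
  then show ?case by simp
qed auto

section \<open>Reverse-complement symmetry\<close>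

text \<open>Subtraction is truncated, so this is an order-reversing involution only for entries up
  to \<open>Suc n\<close>; hence the bounds on \<open>set xs\<close> below.\<close>

definition revcomp :: "nat \<Rightarrow> nat list \<Rightarrow> nat list" where
  "revcomp n xs = rev (map (\<lambda>x. Suc n - x) xs)"

lemma revcomp_in_permutations:
  assumes "xs \<in> permutations_of_set {1..n}"
  shows "revcomp n xs \<in> permutations_of_set {1..n}"
proof -
  have xs: "set xs = {1..n}" "distinct xs" using assms by (auto simp: permutations_of_set_def)
  have "(\<lambda>x. Suc n - x) ` {1..n} = {1..n}"
    by (rule bij_betw_imp_surj_on[OF bij_betwI[of _ _ _ "\<lambda>x. Suc n - x"]]) auto
  then show ?thesis using xs
    by (auto simp: permutations_of_set_def revcomp_def distinct_map inj_on_def)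
qed

lemma revcomp_revcomp: "set xs \<subseteq> {1..n} \<Longrightarrow> revcomp n (revcomp n xs) = xs"
  by (induction xs) (auto simp: revcomp_def)

text \<open>Reversing both positions and values keeps every inversion an inversion. The head becomes
  the last entry, where \<open>num_inv_snoc\<close> counts it.\<close>

lemma num_inv_revcomp: "set xs \<subseteq> {1..n} \<Longrightarrow> num_inv (revcomp n xs) = num_inv xs"
proof (induction xs)
  case (Cons x xs)
  then have "filter ((<) (Suc n - x) \<circ> (-) (Suc n)) xs = filter (\<lambda>y. y < x) xs"
    by (intro filter_cong) auto
  then show ?case using Cons
    by (simp add: revcomp_def num_inv_snoc filter_map flip: rev_map rev_filter)
qed (simp add: revcomp_def)

text \<open>A second application of \<open>revcomp\<close> turns an occurrence of 213 back into a
  132 of \<open>xs\<close>.\<close>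

lemma avoids_213_revcomp:
  assumes "set xs \<subseteq> {1..n}" "avoids xs [1,3,2]"
  shows "avoids (revcomp n xs) [2,1,3]"
  unfolding avoids_213
proof (intro allI impI notI)
  fix a b c
  assume s: "subseq [a, b, c] (revcomp n xs)" and "b < a \<and> a < c"
  from s have "subseq (revcomp n [a, b, c]) (revcomp n (revcomp n xs))"
    unfolding revcomp_def by (intro subseq_rev subseq_map)
  then have "subseq [Suc n - c, Suc n - b, Suc n - a] xs"
    using assms by (simp only: revcomp_revcomp) (simp add: revcomp_def)
  \<comment> \<open>\<open>c\<close> is the largest of the three letters, so this bound rules out
    truncation in all three differences.\<close>
  moreover have "c \<le> n"
  proof -
    have "c \<in> set (revcomp n xs)" using s by (rule subseq_in_set) auto
    then obtain x where "x \<in> set xs" "c = Suc n - x" by (auto simp: revcomp_def)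
    moreover have "1 \<le> x" using \<open>x \<in> set xs\<close> assms(1) by auto
    ultimately show ?thesis by linarith
  qed
  then have "Suc n - c < Suc n - a" "Suc n - a < Suc n - b"
    using \<open>b < a \<and> a < c\<close> by linarith+
  ultimately show False
    using assms(2) unfolding avoids_132 by blast
qed

lemma avoids_132_revcomp:
  assumes "set xs \<subseteq> {1..n}" "avoids xs [2,1,3]"
  shows "avoids (revcomp n xs) [1,3,2]"
  unfolding avoids_132
proof (intro allI impI notI)
  fix a b c
  assume s: "subseq [a, b, c] (revcomp n xs)" and "a < c \<and> c < b"
  from s have "subseq (revcomp n [a, b, c]) (revcomp n (revcomp n xs))"
    unfolding revcomp_def by (intro subseq_rev subseq_map)
  then have "subseq [Suc n - c, Suc n - b, Suc n - a] xs"
    using assms by (simp only: revcomp_revcomp) (simp add: revcomp_def)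
  moreover have "b \<le> n"
  proof -
    have "b \<in> set (revcomp n xs)" using s by (rule subseq_in_set) auto
    then obtain x where "x \<in> set xs" "b = Suc n - x" by (auto simp: revcomp_def)
    moreover have "1 \<le> x" using \<open>x \<in> set xs\<close> assms(1) by auto
    ultimately show ?thesis by linarith
  qed
  then have "Suc n - b < Suc n - c" "Suc n - c < Suc n - a"
    using \<open>a < c \<and> c < b\<close> by linarith+
  ultimately show False
    using assms(2) unfolding avoids_213 by blast
qed

lemma card_avoids_132_eq_213:
  "card {xs \<in> permutations_of_set {1..n}. num_inv xs = k \<and> avoids xs [1,3,2]} =
   card {xs \<in> permutations_of_set {1..n}. num_inv xs = k \<and> avoids xs [2,1,3]}"
    (is "card ?A = card ?B")
proof (rule bij_betw_same_card[of "revcomp n"], rule bij_betwI[of _ _ _ "revcomp n"])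
  have sub: "set xs \<subseteq> {1..n}" if "xs \<in> permutations_of_set {1..n}" for xs
    using permutations_of_setD(1)[OF that] by simp
  show "revcomp n \<in> ?A \<rightarrow> ?B"
  proof
    fix xs assume "xs \<in> ?A"
    then show "revcomp n xs \<in> ?B"
      using sub[of xs] avoids_213_revcomp[of xs n] num_inv_revcomp[of xs n]
        revcomp_in_permutations[of xs n] by simp
  qed
  show "revcomp n \<in> ?B \<rightarrow> ?A"
  proof
    fix xs assume "xs \<in> ?B"
    then show "revcomp n xs \<in> ?A"
      using sub[of xs] avoids_132_revcomp[of xs n] num_inv_revcomp[of xs n]
        revcomp_in_permutations[of xs n] by simp
  qed
  show "revcomp n (revcomp n xs) = xs" if "xs \<in> ?A" for xs
    using that sub by (intro revcomp_revcomp) simp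
  show "revcomp n (revcomp n xs) = xs" if "xs \<in> ?B" for xs
    using that sub by (intro revcomp_revcomp) simp
qed

section \<open>Codes of permutations\<close>

text \<open>The code lists, from the largest value down to \<open>1\<close>, how many smaller entries stand to
  the right of each value.\<close>

fun build :: "nat list \<Rightarrow> nat list" where
  "build [] = []"
| "build (x # ds) =
     take (length ds - x) (build ds) @ Suc (length ds) # drop (length ds - x) (build ds)"

text \<open>A value has only \<open>length ds\<close> smaller ones that can stand to its right.
  Under this bound the subtraction in \<open>build\<close> is exact; any larger entry would just put
  the new maximum in front, and \<open>build\<close> would not be injective.\<close>

fun is_code :: "nat list \<Rightarrow> bool" where
  "is_code [] \<longleftrightarrow> True"
| "is_code (x # ds) \<longleftrightarrow> x \<le> length ds \<and> is_code ds"

lemma length_build [simp]: "length (build ds) = length ds"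
  by (induction ds) auto

lemma build_in_permutations: "build ds \<in> permutations_of_set {1..length ds}"
proof (induction ds)
  case (Cons x ds)
  let ?p = "take (length ds - x) (build ds)" and ?q = "drop (length ds - x) (build ds)"
  have "set (?p @ ?q) = {1..length ds}" "distinct (?p @ ?q)"
    using permutations_of_setD[OF Cons.IH] by simp_all
  then have pq: "set ?p \<union> set ?q = {1..length ds}"
    and d: "distinct ?p" "distinct ?q" "set ?p \<inter> set ?q = {}"
    by (simp_all only: set_append distinct_append)
  have new: "Suc (length ds) \<notin> set ?p \<union> set ?q" unfolding pq by simp
  have "set (build (x # ds)) = insert (Suc (length ds)) {1..length ds}"
    unfolding pq[symmetric] by simp
  also have "\<dots> = {1..length (x # ds)}" by auto
  finally have "set (build (x # ds)) = {1..length (x # ds)}" .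
  moreover have "distinct (build (x # ds))" using d new by simp
  ultimately show ?case by (rule permutations_of_setI)
qed auto

lemmas set_build = permutations_of_setD(1)[OF build_in_permutations]

lemma build_Cons:
  assumes "x \<le> length ds"
  obtains p q where "build ds = p @ q" "length q = x" "length p = length ds - x"
    "build (x # ds) = p @ Suc (length ds) # q"
  using assms that[of "take (length ds - x) (build ds)" "drop (length ds - x) (build ds)"] by simp

lemma build_append_less: "build ds = p @ q \<Longrightarrow> \<forall>x\<in>set (p @ q). x < Suc (length ds)"
  using set_build[of ds] by auto

lemma num_inv_build: "is_code ds \<Longrightarrow> num_inv (build ds) = sum_list ds"
proof (induction ds)
  case (Cons x ds)
  then obtain p q where pq: "build ds = p @ q" "length q = x"
    "build (x # ds) = p @ Suc (length ds) # q"
    by (auto elim: build_Cons)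
  then show ?case
    using Cons num_inv_insert_max[OF build_append_less[OF pq(1)]] by simp
qed simp

text \<open>The maximum occurs once, so its position recovers the first entry of the code, and
  deleting it leaves the list built from the rest.\<close>

lemma build_inject: "is_code ds \<Longrightarrow> is_code es \<Longrightarrow> build ds = build es \<Longrightarrow> ds = es"
proof (induction ds arbitrary: es)
  case (Cons x ds)
  from Cons.prems(3) have "length es = length (x # ds)" by (metis length_build)
  then obtain y fs where es: "es = y # fs" and len: "length fs = length ds"
    by (cases es) auto
  obtain p q where pq: "build ds = p @ q" "length q = x"
    "build (x # ds) = p @ Suc (length ds) # q"
    using Cons.prems by (auto elim: build_Cons)
  obtain p' q' where pq': "build fs = p' @ q'" "length q' = y"
    "build (y # fs) = p' @ Suc (length fs) # q'"
    using Cons.prems es by (auto elim: build_Cons)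
  have "Suc (length ds) \<notin> set (p @ q)" "Suc (length ds) \<notin> set (p' @ q')"
    using build_append_less[OF pq(1)] build_append_less[OF pq'(1)] len by auto
  moreover have "p @ Suc (length ds) # q = p' @ Suc (length ds) # q'"
    using Cons.prems(3) pq(3) pq'(3) es len by metis
  ultimately have "p = p'" "q = q'"
    by (auto simp: append_Cons_eq_iff)
  then show ?case using Cons.IH[of fs] Cons.prems pq pq' es by auto
qed (metis build.simps(1) length_0_conv length_build)

text \<open>Deleting the maximum and recording how many entries stand behind it undoes one step of
  \<open>build\<close>.\<close>

lemma ex_build:
  "xs \<in> permutations_of_set {1..n} \<Longrightarrow> \<exists>ds. is_code ds \<and> length ds = n \<and> build ds = xs"
proof (induction n arbitrary: xs)
  case (Suc n)
  then have xs: "set xs = {1..Suc n}" "distinct xs" by (auto dest: permutations_of_setD)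
  then have "Suc n \<in> set xs" by auto
  then obtain p q where pq: "xs = p @ Suc n # q" by (meson split_list)
  have "p @ q \<in> permutations_of_set {1..n}"
  proof (rule permutations_of_setI)
    have "set (p @ q) = set xs - {Suc n}" using xs(2) unfolding pq by auto
    also have "\<dots> = {1..n}" unfolding xs(1) by auto
    finally show "set (p @ q) = {1..n}" .
  qed (use xs pq in auto)
  from Suc.IH[OF this] obtain ds where ds: "is_code ds" "length ds = n" "build ds = p @ q"
    by blast
  then have len: "n = length p + length q" by (metis length_append length_build)
  have "is_code (length q # ds) \<and> length (length q # ds) = Suc n \<and> build (length q # ds) = xs"
    using ds len pq by simp
  then show ?case by blast
qed auto

lemma bij_betw_build:
  "bij_betw build {ds. is_code ds \<and> length ds = n} (permutations_of_set {1..n})"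
  unfolding bij_betw_def
proof
  show "inj_on build {ds. is_code ds \<and> length ds = n}"
    by (rule inj_onI) (use build_inject in blast)
  show "build ` {ds. is_code ds \<and> length ds = n} = permutations_of_set {1..n}"
  proof
    show "build ` {ds. is_code ds \<and> length ds = n} \<subseteq> permutations_of_set {1..n}"
      using build_in_permutations by blast
    show "permutations_of_set {1..n} \<subseteq> build ` {ds. is_code ds \<and> length ds = n}"
    proof
      fix xs assume "xs \<in> permutations_of_set {1..n}"
      from ex_build[OF this] show "xs \<in> build ` {ds. is_code ds \<and> length ds = n}" by blast
    qed
  qed
qed

section \<open>Inserting a maximum, and avoidance of 213\<close>

text \<open>Sortedness is avoidance of 21, which is how it enters the pattern arguments.\<close>

lemma sorted_iff_subseq: "sorted xs \<longleftrightarrow> (\<forall>a b. subseq [a, b] xs \<longrightarrow> a \<le> b)"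
  for xs :: "'a::linorder list"
proof (induction xs)
  case (Cons x xs)
  have "subseq [a, b] (x # xs) \<longleftrightarrow> a = x \<and> b \<in> set xs \<or> subseq [a, b] xs" for a b
    using subseq2_append[of a b "[x]" xs] by auto
  then show ?case using Cons by auto
qed simp

lemma avoids_Nil [simp]: "q \<noteq> [] \<Longrightarrow> avoids [] q"
  by (simp add: avoids_def order_isomorphic_def)

lemma avoids_remove1: "avoids (p @ x # q) r \<Longrightarrow> avoids (p @ q) r"
  by (erule avoids_subseq) (auto intro: list_emb_append_mono)

text \<open>A new maximum can only play the 3, and then the 21 lies in \<open>p\<close>.\<close>

lemma avoids_213_insert_max:
  assumes "\<forall>x\<in>set (p @ q). x < N"
  shows "avoids (p @ N # q) [2,1,3] \<longleftrightarrow> avoids (p @ q) [2,1,3] \<and> sorted p"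
proof
  assume av: "avoids (p @ N # q) [2,1,3]"
  have "a \<le> b" if "subseq [a, b] p" for a b
  proof (rule ccontr)
    assume "\<not> a \<le> b"
    moreover have "a < N" using subseq_in_set[OF that, of a] assms by auto
    moreover have "subseq [a, b, N] (p @ N # q)" using that by (auto simp: subseq3_append)
    ultimately show False using av unfolding avoids_213 by force
  qed
  then show "avoids (p @ q) [2,1,3] \<and> sorted p"
    using avoids_remove1[OF av] by (simp add: sorted_iff_subseq)
next
  assume *: "avoids (p @ q) [2,1,3] \<and> sorted p"
  show "avoids (p @ N # q) [2,1,3]"
    unfolding avoids_213
  proof (intro allI impI notI)
    fix a b c assume s: "subseq [a, b, c] (p @ N # q)" and abc: "b < a \<and> a < c"
    have "x \<le> N" if "x \<in> set (p @ N # q)" for x using that assms by (auto intro: less_imp_le)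
    then have "c \<le> N" using subseq_in_set[OF s, of c] by simp
    have "\<not> subseq [a, b] p" using * abc unfolding sorted_iff_subseq by (meson leD)
    moreover have "N \<noteq> a" "N \<noteq> b" using abc \<open>c \<le> N\<close> by auto
    ultimately have "subseq [a, b, c] (p @ q)"
      using s by (auto simp: subseq3_append subseq_singleton_left split: if_splits)
    then show False using * abc unfolding avoids_213 by blast
  qed
qed

text \<open>A new maximum can only play the 4, with the 2 in \<open>p\<close> and the 31 in
  \<open>q\<close>.\<close>

lemma avoids_2431_insert_max:
  assumes "\<forall>x\<in>set (p @ q). x < N"
  shows "avoids (p @ N # q) [2,4,3,1] \<longleftrightarrow>
    avoids (p @ q) [2,4,3,1] \<and> (\<forall>a\<in>set p. \<forall>c d. subseq [c, d] q \<longrightarrow> \<not> (d < a \<and> a < c))"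
proof
  assume av: "avoids (p @ N # q) [2,4,3,1]"
  have "\<not> (d < a \<and> a < c)" if "a \<in> set p" "subseq [c, d] q" for a c d
  proof -
    have "c < N" using subseq_in_set[OF that(2), of c] assms by auto
    moreover have "subseq [a, N, c, d] (p @ N # q)" using that by (auto simp: subseq4_append)
    ultimately show ?thesis using av unfolding avoids_2431 by blast
  qed
  then show "avoids (p @ q) [2,4,3,1] \<and>
      (\<forall>a\<in>set p. \<forall>c d. subseq [c, d] q \<longrightarrow> \<not> (d < a \<and> a < c))"
    using avoids_remove1[OF av] by blast
next
  assume *: "avoids (p @ q) [2,4,3,1] \<and>
      (\<forall>a\<in>set p. \<forall>c d. subseq [c, d] q \<longrightarrow> \<not> (d < a \<and> a < c))"
  show "avoids (p @ N # q) [2,4,3,1]"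
    unfolding avoids_2431
  proof (intro allI impI notI)
    fix a b c d assume s: "subseq [a, b, c, d] (p @ N # q)" and abc: "d < a \<and> a < c \<and> c < b"
    have "x \<le> N" if "x \<in> set (p @ N # q)" for x using that assms by (auto intro: less_imp_le)
    then have "b \<le> N" using subseq_in_set[OF s, of b] by simp
    then have ne: "N \<noteq> a" "N \<noteq> c" "N \<noteq> d" using abc by auto
    have "subseq [a, b, c, d] (p @ q)"
      using s ne * abc
      by (auto simp: subseq4_append subseq_singleton_left split: if_splits)
    then show False using * abc unfolding avoids_2431 by blast
  qed
qed

text \<open>Let the last inserted maximum have \<open>y\<close> entries behind it. What precedes it
  is increasing and what follows is smaller, so increasing prefixes end with it at the latest. The
  next maximum must follow an increasing prefix, which means that at least \<open>y\<close> entries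
  stand to its right.\<close>

lemma avoids_213_build:
  "is_code ds \<Longrightarrow> avoids (build ds) [2,1,3] \<longleftrightarrow> sorted_wrt (\<ge>) ds"
proof (induction ds)
  case Nil
  show ?case by simp
next
  case (Cons x ds)
  obtain p q where pq: "build ds = p @ q" "length q = x" "length p = length ds - x"
    "build (x # ds) = p @ Suc (length ds) # q"
    using Cons.prems by (auto elim: build_Cons)
  have av: "avoids (build (x # ds)) [2,1,3] \<longleftrightarrow> avoids (build ds) [2,1,3] \<and> sorted p"
    using avoids_213_insert_max[OF build_append_less[OF pq(1)]] pq by simp
  show ?case
  proof (cases ds)
    case Nil
    then show ?thesis using av pq by simp
  next
    case ds: (Cons y es)
    then obtain p' q' where pq': "build es = p' @ q'" "length q' = y" "length p' = length es - y"
      "build ds = p' @ Suc (length es) # q'"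
      using Cons.prems by (auto elim: build_Cons)
    let ?N = "Suc (length es)"
    have lt: "\<forall>x\<in>set (p' @ q'). x < ?N" by (rule build_append_less[OF pq'(1)])
    have p: "p = take (?N - x) (p' @ ?N # q')"
      using pq pq' ds by (metis append_eq_conv_conj length_Cons)
    have "sorted p \<longleftrightarrow> y \<le> x" if "sorted p'"
    proof
      assume "y \<le> x"
      \<comment> \<open>At most \<open>length p' + 1\<close> entries are taken, so \<open>q'\<close>
        is not reached.\<close>
      then have "p = take (?N - x) (p' @ [?N])"
        using p pq'(3) Cons.prems ds by (auto simp: take_Cons')
      moreover have "sorted (p' @ [?N])"
        using that lt by (auto simp: sorted_append less_imp_le)
      ultimately show "sorted p" by (simp only: sorted_wrt_take)
    next
      assume "sorted p"
      show "y \<le> x"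
      proof (rule ccontr)
        assume "\<not> y \<le> x"
        moreover have "y \<le> length es" using Cons.prems ds by simp
        \<comment> \<open>\<open>p\<close> extends at least two entries beyond \<open>p'\<close>:
          over \<open>?N\<close> and over the smaller head of \<open>q'\<close>.\<close>
        ultimately have len: "?N - x = length p' + Suc (Suc (y - x - 1))" and "q' \<noteq> []"
          using pq'(2,3) by auto
        from \<open>q' \<noteq> []\<close> obtain z zs where "q' = z # zs" by (cases q') auto
        then have "p = p' @ ?N # z # take (y - x - 1) zs" unfolding p len by simp
        moreover have "z < ?N" using lt \<open>q' = z # zs\<close> by simp
        ultimately show False using \<open>sorted p\<close> by (auto simp: sorted_append)
      qed
    qed
    moreover have "avoids (build ds) [2,1,3] \<Longrightarrow> sorted p'"
      using avoids_213_insert_max[OF lt] pq'(4) by simp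
    moreover have "avoids (build ds) [2,1,3] \<longleftrightarrow> sorted_wrt (\<ge>) ds"
      using Cons by simp
    moreover have "sorted_wrt (\<ge>) (x # ds) \<longleftrightarrow> y \<le> x \<and> sorted_wrt (\<ge>) ds"
      using ds by auto
    ultimately show ?thesis using av by blast
  qed
qed

section \<open>Steep partitions and avoidance of 2431\<close>

lemma steep_empty [simp]: "steep {#}"
  by (simp add: steep_def)

lemma steep_single [simp]: "steep {#x#}"
  by (simp add: steep_def)

text \<open>Only the gap from the old maximum \<open>y\<close> to \<open>x\<close> can be new. If
  \<open>x = y\<close>, there is no new gap, and the larger multiplicity is that of the largest
  part, which is unconstrained.\<close>

lemma steep_add_mset_max:
  assumes "y \<in># p" "\<And>z. z \<in># p \<Longrightarrow> z \<le> y" "y \<le> x"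
  shows "steep (add_mset x p) \<longleftrightarrow> steep p \<and> (x = y \<or> count p y \<le> x - y)"
proof
  assume st: "steep (add_mset x p)"
  have "count p a \<le> b - a"
    if "a \<in># p" "b \<in># p" "a < b" "\<not> (\<exists>c. c \<in># p \<and> a < c \<and> c < b)" for a b
  proof -
    have "b \<le> x" using that(2) assms(2,3) order_trans by blast
    then have "count (add_mset x p) a \<le> b - a"
      using that by (intro st[unfolded steep_def, rule_format]) auto
    then show ?thesis using \<open>b \<le> x\<close> that by simp
  qed
  then have "steep p" by (auto simp: steep_def)
  moreover have "count p y \<le> x - y" if "x \<noteq> y"
  proof -
    have "count (add_mset x p) y \<le> x - y"
      using that assms(1,3)
      by (intro st[unfolded steep_def, rule_format]) (auto dest: assms(2))
    then show ?thesis using that by simp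
  qed
  ultimately show "steep p \<and> (x = y \<or> count p y \<le> x - y)" by blast
next
  assume *: "steep p \<and> (x = y \<or> count p y \<le> x - y)"
  show "steep (add_mset x p)"
    unfolding steep_def
  proof (intro allI impI, elim conjE)
    fix a b
    assume ab: "a \<in># add_mset x p" "b \<in># add_mset x p" "a < b"
      "\<not> (\<exists>c. c \<in># add_mset x p \<and> a < c \<and> c < b)"
    have "b \<le> x" using ab(2) assms(2,3) by (auto intro: order_trans)
    then have "a < x" "a \<in># p" using ab(1,3) by auto
    then have ct: "count (add_mset x p) a = count p a" by simp
    have "count p a \<le> b - a"
    proof (cases "b \<in># p")
      case True
      then show ?thesis using * ab(3,4) \<open>a \<in># p\<close> by (auto simp: steep_def)
    next
      case False
      then have "b = x" "x \<noteq> y" using ab(2) assms(1) by auto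
      \<comment> \<open>Otherwise \<open>y\<close> would lie strictly between \<open>a\<close> and
        \<open>x\<close>.\<close>
      moreover have "a = y"
        using ab(3,4) \<open>b = x\<close> \<open>x \<noteq> y\<close> assms(1,3) assms(2)[OF \<open>a \<in># p\<close>]
        by (auto simp: le_less)
      ultimately show ?thesis using * by simp
    qed
    then show "count (add_mset x p) a \<le> b - a" using ct by simp
  qed
qed

abbreviation parts :: "nat list \<Rightarrow> nat multiset" where
  "parts ds \<equiv> filter_mset (\<lambda>d. 0 < d) (mset ds)"

lemma build_replicate_0: "build (replicate n 0) = [1..<Suc n]"
  by (induction n) auto

lemma sorted_wrt_ge_hd_0: "sorted_wrt (\<ge>) (0 # ds) \<Longrightarrow> ds = replicate (length ds) (0::nat)"
  by (simp add: list_eq_iff_nth_eq)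

lemma avoids_2431_upt: "avoids [i..<j] [2,4,3,1]"
  unfolding avoids_2431
proof (intro allI impI)
  fix a b c d assume "subseq [a, b, c, d] [i..<j]"
  then have "subseq [c, d] [i..<j]" by (rule subseq_Cons'[OF subseq_Cons'])
  then have "c \<le> d" using sorted_iff_subseq[of "[i..<j]"] sorted_upt by blast
  then show "\<not> (d < a \<and> a < c \<and> c < b)" by simp
qed

text \<open>This is the shape of the permutations with a steep code whose largest part \<open>y\<close> is positive
  and occurs \<open>m\<close> times. The next maximum is inserted \<open>x \<ge> y\<close> places from the right. It creates
  a 2431 exactly if it falls strictly inside the block of the last \<open>m\<close> values, which then
  provide the 2 and the 3, whereas \<open>q\<close> provides the 1.\<close>

definition block_form :: "nat list \<Rightarrow> nat \<Rightarrow> nat \<Rightarrow> bool" where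
  "block_form xs y m \<longleftrightarrow> (\<exists>w q. y \<le> w \<and> length xs = w + m \<and> length q = y \<and>
     set q = {w - y<..w} \<and> xs = [1..<Suc (w - y)] @ [Suc w..<Suc (w + m)] @ q)"

text \<open>Both claims go through one induction, since the explicit shape decides whether the next
  insertion creates a 2431. Avoidance and steepness, once lost, stay lost, so the shape is needed
  only for steep codes; codes of zeros alone build the identity and are treated apart.\<close>

lemma build_steep:
  assumes "is_code ds" "sorted_wrt (\<ge>) ds"
  shows "(avoids (build ds) [2,4,3,1] \<longleftrightarrow> steep (parts ds)) \<and>
    (steep (parts ds) \<and> ds \<noteq> [] \<and> 0 < hd ds \<longrightarrow>
       block_form (build ds) (hd ds) (count (mset ds) (hd ds)))"
  using assms
proof (induction ds)
  case (Cons x ds)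
  let ?n = "length ds"
  have x: "x \<le> ?n" "is_code ds" using Cons.prems by auto
  obtain p q where pq: "build ds = p @ q" "length q = x" "length p = ?n - x"
    "build (x # ds) = p @ Suc ?n # q"
    using x(1) by (rule build_Cons)
  have av: "avoids (build (x # ds)) [2,4,3,1] \<longleftrightarrow> avoids (build ds) [2,4,3,1] \<and>
      (\<forall>a\<in>set p. \<forall>c d. subseq [c, d] q \<longrightarrow> \<not> (d < a \<and> a < c))"
    using avoids_2431_insert_max[OF build_append_less[OF pq(1)]] pq by simp
  have take: "p = take (?n - x) (build ds)" and drop: "q = drop (?n - x) (build ds)"
    using pq by simp_all
  show ?case
  proof (cases "\<exists>y es. ds = y # es \<and> 0 < y")
    case False
    \<comment> \<open>With only zeros so far, \<open>build ds\<close> is the identity, and every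
      insertion leaves \<open>q\<close> increasing, so that it contains no 31.\<close>
    then have ds: "ds = replicate ?n 0"
      using Cons.prems sorted_wrt_ge_hd_0 by (cases ds) auto
    then have b: "build ds = [1..<Suc ?n]" by (metis build_replicate_0)
    have "\<forall>d\<in>set ds. d = 0" by (subst ds) simp
    then have "parts ds = {#}" by (intro multiset_eqI) (auto simp: count_eq_zero_iff)
    then have "steep (parts (x # ds))" by (auto simp only: mset.simps filter_mset_add_mset
      steep_empty steep_single split: if_split)
    have p: "p = [1..<Suc (?n - x)]" and q: "q = [Suc (?n - x)..<Suc ?n]"
      using take drop x(1) unfolding b by (simp_all add: take_upt drop_upt del: upt_Suc)
    have "sorted q" unfolding q by (rule sorted_upt)
    then have "c \<le> d" if "subseq [c, d] q" for c d
      using that sorted_iff_subseq[of q] by blast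
    then have "avoids (build (x # ds)) [2,4,3,1]"
      unfolding av b using avoids_2431_upt by (meson leD less_trans)
    moreover have "block_form (build (x # ds)) x (count (mset (x # ds)) x)" if "0 < x"
    proof -
      have "count (mset (x # ds)) x = 1"
        using that \<open>\<forall>d\<in>set ds. d = 0\<close> by (auto simp: count_eq_zero_iff)
      \<comment> \<open>The block is the new maximum \<open>Suc ?n\<close> alone, hence
        \<open>?n\<close> for \<open>w\<close>.\<close>
      moreover have "block_form (build (x # ds)) x 1"
        unfolding block_form_def pq(4)
        by (rule exI[of _ ?n], rule exI[of _ q])
          (use x(1) pq(2,3) p q in \<open>auto simp del: upt_Suc simp: upt_rec[of "Suc ?n"]\<close>)
      ultimately show ?thesis by metis
    qed
    ultimately show ?thesis using \<open>steep (parts (x # ds))\<close> by (metis list.sel(1))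
  next
    case True
    then obtain y es where y: "ds = y # es" "0 < y" by blast
    define m where "m = count (mset ds) y"
    have le: "y \<le> x" "\<And>z. z \<in> set ds \<Longrightarrow> z \<le> y" using Cons.prems(2) y by auto
    have m: "0 < m" "count (parts ds) y = m" using y by (auto simp: m_def)
    have st: "steep (parts (x # ds)) \<longleftrightarrow> steep (parts ds) \<and> (x = y \<or> m \<le> x - y)"
    proof -
      have "parts (x # ds) = add_mset x (parts ds)" using le y by auto
      moreover have "y \<in># parts ds" using y by auto
      moreover have "z \<le> y" if "z \<in># parts ds" for z using that le(2)[of z] by simp
      ultimately show ?thesis using steep_add_mset_max[of y "parts ds" x] le(1) m(2) by simp
    qed
    have IH: "avoids (build ds) [2,4,3,1] \<longleftrightarrow> steep (parts ds)"
      "steep (parts ds) \<Longrightarrow> block_form (build ds) y m"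
      using Cons.IH x(2) Cons.prems(2) y by (auto simp: m_def)
    show ?thesis
    proof (cases "steep (parts ds)")
      case False
      then show ?thesis using av IH(1) st by simp
    next
      case steep: True
      then obtain w q0 where w: "y \<le> w" "?n = w + m" "length q0 = y" "set q0 = {w - y<..w}"
        and b: "build ds = [1..<Suc (w - y)] @ [Suc w..<Suc (w + m)] @ q0"
        using IH(2) by (auto simp: block_form_def)
      have hdx: "hd (x # ds) = x" by simp
      \<comment> \<open>The new maximum lands directly behind the block, at or before its start, or
        strictly inside it.\<close>
      consider (eq) "x = y" | (far) "y < x" "m \<le> x - y" | (near) "y < x" "x < y + m"
        using le(1) by linarith
      then show ?thesis
      proof cases
        case eq
        have p: "p = [1..<Suc (w - y)] @ [Suc w..<Suc (w + m)]" and q: "q = q0"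
          using take drop w eq unfolding b by (simp_all del: upt_Suc)
        \<comment> \<open>The values of \<open>q\<close> fill the interval
          \<open>{w - y<..w}\<close>, which no value of \<open>p\<close> meets, so no value of
          \<open>p\<close> lies between two values of \<open>q\<close>.\<close>
        have "\<not> (d < a \<and> a < c)" if "a \<in> set p" "subseq [c, d] q" for a c d
        proof -
          have "c \<in> {w - y<..w}" "d \<in> {w - y<..w}"
            using subseq_in_set[OF that(2)] w(4) q by auto
          then show ?thesis using that(1) p by auto
        qed
        then have "avoids (build (x # ds)) [2,4,3,1]" using av IH(1) steep by blast
        moreover have "block_form (build (x # ds)) x (Suc m)"
          unfolding block_form_def pq(4)
        proof (rule exI[of _ w], rule exI[of _ q], intro conjI)
          have "[Suc w..<Suc (w + Suc m)] = [Suc w..<Suc (w + m)] @ [Suc ?n]"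
            using upt_Suc_append[of "Suc w" "Suc (w + m)"] w(2) by simp
          then show "p @ Suc ?n # q = [1..<Suc (w - x)] @ [Suc w..<Suc (w + Suc m)] @ q"
            unfolding p eq by (simp only: append_assoc append_Cons append_Nil)
        qed (use w q eq pq(2,3) in simp_all)
        moreover have "count (mset (x # ds)) x = Suc m" using eq m_def by simp
        ultimately show ?thesis using st steep eq by (metis list.sel(1))
      next
        case far
        \<comment> \<open>The insertion point lies in or at the end of the initial run, so
          \<open>p\<close> holds the smallest values and none of them can be the 2.\<close>
        have le': "?n - x \<le> w - y" using far w by linarith
        have p: "p = [1..<Suc (?n - x)]"
          and q: "q = [Suc (?n - x)..<Suc (w - y)] @ [Suc w..<Suc (w + m)] @ q0"
          using take drop le' unfolding b by (simp_all add: take_upt drop_upt del: upt_Suc)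
        have "set q \<subseteq> {?n - x<..}" using le' w(1,4) unfolding q by auto
        then have "\<not> (d < a \<and> a < c)" if "a \<in> set p" "subseq [c, d] q" for a c d
          using subseq_in_set[OF that(2), of d] that(1) p by auto
        then have "avoids (build (x # ds)) [2,4,3,1]" using av IH(1) steep by blast
        \<comment> \<open>\<open>Suc ?n\<close> starts a new block; everything behind it, including
          the old block, becomes the new \<open>q\<close>.\<close>
        moreover have "block_form (build (x # ds)) x 1"
          unfolding block_form_def pq(4)
        proof (rule exI[of _ ?n], rule exI[of _ q], intro conjI)
          have "set q = {Suc (?n - x)..<Suc (w - y)} \<union> {Suc w..<Suc (w + m)} \<union> {w - y<..w}"
            unfolding q by (simp only: set_append set_upt w(4) Un_assoc)
          also have "\<dots> = {?n - x<..?n}" using le' w(1,2) by auto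
          finally show "set q = {?n - x<..?n}" .
          show "p @ Suc ?n # q = [1..<Suc (?n - x)] @ [Suc ?n..<Suc (?n + 1)] @ q"
            unfolding p by simp
        qed (use x(1) pq(2,3) in simp_all)
        moreover have "x \<notin> set ds" using le(2) far(1) by (meson leD)
        then have "count (mset (x # ds)) x = 1" by simp
        ultimately show ?thesis using st steep far by (metis list.sel(1))
      next
        case near
        \<comment> \<open>The number of block entries in front of the new maximum.\<close>
        define k where "k = ?n - x - (w - y)"
        have k: "0 < k" "k < m" "?n - x = w - y + k" using near w by (auto simp: k_def)
        have p: "p = [1..<Suc (w - y)] @ [Suc w..<Suc (w + k)]"
          and q: "q = [Suc (w + k)..<Suc (w + m)] @ q0"
          using take drop k unfolding b by (simp_all add: take_upt drop_upt del: upt_Suc)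
        \<comment> \<open>\<open>q0\<close> is nonempty because \<open>0 < y\<close>. Its entry
          \<open>d\<close> is the 1 of a 2431 whose 2 is \<open>Suc w\<close>, whose 4 is the new
          maximum and whose 3 is \<open>w + m\<close>.\<close>
        obtain d where d: "d \<in> set q0" using w(3) y(2) by (cases q0) auto
        have "subseq [w + m, d] q" using k d unfolding q subseq2_append
          by (auto simp: subseq_singleton_left)
        moreover have "Suc w \<in> set p" using k p by auto
        moreover have "d < Suc w" "Suc w < w + m" using d w(4) k by auto
        ultimately have "\<not> avoids (build (x # ds)) [2,4,3,1]" using av by blast
        then show ?thesis using st near by auto
      qed
    qed
  qed
qed simp

section \<open>Partitions as zero-padded codes\<close>

text \<open>The head is at most the sum. Dropping a positive head lowers the sum by at least one and
  the length by exactly one, so the bound is inherited; behind a zero head there are only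
  zeros.\<close>

lemma is_code_if_sum_list_less_length:
  "sorted_wrt (\<ge>) ds \<Longrightarrow> sum_list ds < length ds \<Longrightarrow> is_code ds"
proof (induction ds)
  case (Cons x ds)
  show ?case
  proof (cases "x = 0")
    case True
    then have "sum_list ds = 0" using Cons.prems by auto
    then have "sum_list ds < length ds" if "ds \<noteq> []" using that by (metis length_greater_0_conv)
    moreover have "is_code []" by simp
    ultimately have "is_code ds" using Cons by (metis sorted_wrt.simps(2))
    then show ?thesis using True by simp
  next
    case False
    then show ?thesis using Cons by simp
  qed
qed simp

lemma sum_mset_parts: "sum_mset (parts ds) = sum_list ds"
  by (induction ds) auto

text \<open>For a given length, the positive parts determine the number of zeros. This makes
  \<open>parts\<close> injective on sorted lists of equal length.\<close>

lemma mset_eq_parts: "mset ds = parts ds + replicate_mset (length ds - size (parts ds)) 0"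
proof -
  have "filter_mset (\<lambda>d. \<not> 0 < d) (mset ds) = replicate_mset (count (mset ds) 0) 0"
    by (intro multiset_eqI) simp
  then have eq: "mset ds = parts ds + replicate_mset (count (mset ds) 0) 0"
    using multiset_partition[of "mset ds" "\<lambda>d. 0 < d"] by simp
  then have "size (mset ds) = size (parts ds) + count (mset ds) 0"
    by (metis size_replicate_mset size_union)
  then have "count (mset ds) 0 = length ds - size (parts ds)" by simp
  then show ?thesis using eq by simp
qed

lemma size_le_sum_mset: "0 \<notin># p \<Longrightarrow> size p \<le> sum_mset p" for p :: "nat multiset"
  by (induction p) auto

text \<open>A partition of \<open>k\<close> has at most \<open>k\<close> parts, so
  \<open>k < n\<close> leaves room to pad it with zeros to length \<open>n\<close>. It also makes
  the sum smaller than the length, so that the padded list is a code.\<close>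

lemma bij_betw_parts:
  assumes "k < n"
  shows "bij_betw parts {ds. is_code ds \<and> length ds = n \<and> sorted_wrt (\<ge>) ds \<and> sum_list ds = k}
    (partitions k)" (is "bij_betw _ ?C _")
  unfolding bij_betw_def
proof
  show "inj_on parts ?C"
  proof (rule inj_onI)
    fix ds es assume ds: "ds \<in> ?C" and es: "es \<in> ?C" and "parts ds = parts es"
    then have "mset (rev ds) = mset (rev es)"
      using mset_eq_parts[of ds] mset_eq_parts[of es] by simp
    moreover have "sorted (rev ds)" "sorted (rev es)"
      using ds es by (simp_all add: sorted_wrt_rev)
    ultimately have "rev ds = rev es" by (metis properties_for_sort)
    then show "ds = es" by simp
  qed
  show "parts ` ?C = partitions k"
  proof
    show "parts ` ?C \<subseteq> partitions k" by (auto simp: partitions_def sum_mset_parts)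
    show "partitions k \<subseteq> parts ` ?C"
    proof
      fix p assume "p \<in> partitions k"
      then have p: "0 \<notin># p" "sum_mset p = k" by (auto simp: partitions_def)
      then have "size p \<le> n" using size_le_sum_mset[of p] assms by simp
      define ds where "ds = rev (sorted_list_of_multiset (p + replicate_mset (n - size p) 0))"
      have m: "mset ds = p + replicate_mset (n - size p) 0" by (simp add: ds_def)
      have "size (mset ds) = n" unfolding m using \<open>size p \<le> n\<close> by simp
      moreover have "sorted_wrt (\<ge>) ds" unfolding ds_def by (simp add: sorted_wrt_rev)
      moreover have "sum_list ds = k"
        using p(2) by (simp add: m flip: sum_mset_sum_list)
      ultimately have "ds \<in> ?C" using assms is_code_if_sum_list_less_length by auto
      moreover have "parts ds = p"
        unfolding m using p(1) by (intro multiset_eqI) (auto simp: not_in_iff)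
      ultimately show "p \<in> parts ` ?C" by blast
    qed
  qed
qed

lemma bij_betw_build_avoids_213:
  "bij_betw build {ds. is_code ds \<and> length ds = n \<and> sorted_wrt (\<ge>) ds \<and> sum_list ds = k}
    {xs \<in> permutations_of_set {1..n}. num_inv xs = k \<and> avoids xs [2,1,3]}"
proof -
  have "bij_betw build
     {ds \<in> {ds. is_code ds \<and> length ds = n}. sorted_wrt (\<ge>) ds \<and> sum_list ds = k}
     {xs \<in> permutations_of_set {1..n}. num_inv xs = k \<and> avoids xs [2,1,3]}"
    by (rule bij_betw_Collect[OF bij_betw_build])
      (auto simp: num_inv_build avoids_213_build simp del: One_nat_def)
  then show ?thesis by (simp add: conj_assoc)
qed

lemma card_avoids_213:
  assumes "k < n"
  shows "card {xs \<in> permutations_of_set {1..n}. num_inv xs = k \<and> avoids xs [2,1,3]} =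
    card (partitions k)"
  using bij_betw_same_card[OF bij_betw_build_avoids_213] bij_betw_same_card[OF bij_betw_parts[OF assms]]
  by simp

lemma card_avoids_213_2431:
  assumes "k < n"
  shows "card {xs \<in> permutations_of_set {1..n}.
      num_inv xs = k \<and> avoids xs [2,1,3] \<and> avoids xs [2,4,3,1]} =
    card {p \<in> partitions k. steep p}"
proof -
  let ?C = "{ds. is_code ds \<and> length ds = n \<and> sorted_wrt (\<ge>) ds \<and> sum_list ds = k}"
  have "bij_betw build {ds \<in> ?C. steep (parts ds)}
      {xs \<in> {xs \<in> permutations_of_set {1..n}. num_inv xs = k \<and> avoids xs [2,1,3]}.
        avoids xs [2,4,3,1]}"
    by (rule bij_betw_Collect[OF bij_betw_build_avoids_213]) (use build_steep in auto)
  moreover have "bij_betw parts {ds \<in> ?C. steep (parts ds)} {p \<in> partitions k. steep p}"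
    by (rule bij_betw_Collect[OF bij_betw_parts[OF assms]]) auto
  ultimately show ?thesis by (auto dest!: bij_betw_same_card simp: conj_assoc)
qed

section \<open>Cuts\<close>

text \<open>Inserting a new maximum with \<open>l\<close> entries to its right adds \<open>l\<close> inversions and destroys at
  most \<open>l\<close> of the cuts.\<close>

lemma card_non_cuts_le_num_inv:
  "xs \<in> permutations_of_set {1..n} \<Longrightarrow>
     card {s. s \<le> n \<and> set (take s xs) \<noteq> {1..s}} \<le> num_inv xs"
proof (induction n arbitrary: xs)
  case (Suc n)
  let ?noncuts = "\<lambda>n xs. {s. s \<le> n \<and> set (take s xs) \<noteq> {1..s}}"
  have xs: "set xs = {1..Suc n}" "distinct xs" using Suc.prems by (auto dest: permutations_of_setD)
  then have "Suc n \<in> set xs" by simp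
  then obtain p q where pq: "xs = p @ Suc n # q" by (meson split_list)
  have pq_set: "set (p @ q) = {1..n}"
  proof -
    have "set (p @ q) = set xs - {Suc n}" using xs(2) unfolding pq by auto
    also have "\<dots> = {1..n}" unfolding xs(1) by auto
    finally show ?thesis .
  qed
  then have perm: "p @ q \<in> permutations_of_set {1..n}"
    using xs(2) pq by (intro permutations_of_setI) auto
  have len: "length p + length q = n"
    using length_finite_permutations_of_set[OF perm] by simp
  \<comment> \<open>Up to \<open>length p\<close> the prefixes of both lists agree, and the full
    prefix is a cut. Only the \<open>length q\<close> positions in \<open>{length p<..n}\<close> can
    lose a cut.\<close>
  have "?noncuts (Suc n) xs \<subseteq> ?noncuts n (p @ q) \<union> {length p<..n}"
  proof
    fix s assume s: "s \<in> ?noncuts (Suc n) xs"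
    have "length xs = Suc n" using len by (simp add: pq)
    then have "take (Suc n) xs = xs" by simp
    then have "s \<noteq> Suc n" using s xs(1) by force
    then show "s \<in> ?noncuts n (p @ q) \<union> {length p<..n}"
      using s by (cases "s \<le> length p") (auto simp: pq)
  qed
  then have "card (?noncuts (Suc n) xs) \<le> card (?noncuts n (p @ q) \<union> {length p<..n})"
    by (intro card_mono) auto
  also have "\<dots> \<le> card (?noncuts n (p @ q)) + length q"
    using card_Un_le[of "?noncuts n (p @ q)" "{length p<..n}"] len by simp
  also have "\<dots> \<le> num_inv (p @ q) + length q" using Suc.IH[OF perm] by simp
  also have "\<dots> = num_inv xs"
  proof -
    have "\<forall>x\<in>set (p @ q). x < Suc n" unfolding pq_set by simp
    from num_inv_insert_max[OF this] show ?thesis by (simp add: pq)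
  qed
  finally show ?case .
qed (auto simp: set_eq_iff)

lemma ex_cut:
  assumes "xs \<in> permutations_of_set {1..n}" "S \<subseteq> {..n}" "num_inv xs < card S"
  shows "\<exists>s\<in>S. set (take s xs) = {1..s}"
proof (rule ccontr)
  assume "\<not> ?thesis"
  then have "card S \<le> card {s. s \<le> n \<and> set (take s xs) \<noteq> {1..s}}"
    using assms(2) by (intro card_mono) auto
  then show False using card_non_cuts_le_num_inv[OF assms(1)] assms(3) by simp
qed

text \<open>There is a cut close to either end. Between the two, a descent would be the 32 of a 1324, so
  every position in the middle is a cut.\<close>

lemma split_at_cut:
  assumes xs: "xs \<in> permutations_of_set {1..n}"
    and av: "avoids xs [1,3,2,4]" and n: "2 * num_inv xs + 2 \<le> n"
    and M: "M = Suc (num_inv xs)"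
  shows "set (take M xs) = {1..M}"
proof -
  note set_xs = permutations_of_setD[OF xs]
  have len: "length xs = n" using length_finite_permutations_of_set[OF xs] by simp
  \<comment> \<open>Both ranges have \<open>M\<close> positions, one more than there can be
    non-cuts, and \<open>2 * M \<le> n\<close> puts \<open>s\<close> and \<open>t\<close> on either
    side of \<open>M\<close>. The trivial cuts 0 and \<open>n\<close> are left out so that 1 lies
    before \<open>s\<close> and \<open>n\<close> behind \<open>t\<close>.\<close>
  have "\<exists>s\<in>{1..M}. set (take s xs) = {1..s}"
    using n M by (intro ex_cut[OF xs]) auto
  then obtain s where s: "1 \<le> s" "s \<le> M" "set (take s xs) = {1..s}" by auto
  have "\<exists>t\<in>{n - M..<n}. set (take t xs) = {1..t}"
    using n M by (intro ex_cut[OF xs]) auto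
  then obtain t where t: "n - M \<le> t" "t < n" "set (take t xs) = {1..t}" by auto
  have Mt: "M \<le> t" using n M t by linarith
  define A B C where "A = take s xs" and "B = drop s (take t xs)" and "C = drop t xs"
  have "take t xs = A @ B"
    using append_take_drop_id[of s "take t xs"] s(2) Mt by (simp add: A_def B_def min_def)
  then have eq: "xs = A @ B @ C" using append_take_drop_id[of t xs] by (simp add: C_def)
  have dist: "distinct A" "distinct B" "set A \<inter> set B = {}" "set (take t xs) \<inter> set C = {}"
    using set_xs(2) \<open>take t xs = A @ B\<close> unfolding eq by auto
  have "set B = set (take t xs) - set A" using dist(3) \<open>take t xs = A @ B\<close> by auto
  also have "\<dots> = {s<..t}" unfolding t(3) using s(3) by (auto simp: A_def)
  finally have setB: "set B = {s<..t}" .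
  have "sorted B"
  proof (rule ccontr)
    assume "\<not> sorted B"
    then obtain b c where bc: "subseq [b, c] B" "c < b"
      unfolding sorted_iff_subseq by (meson not_le)
    then have "c \<in> {s<..t}" "b \<in> {s<..t}" using subseq_in_set[OF bc(1)] setB by auto
    moreover have "1 \<in> set A" using s by (simp add: A_def)
    moreover have "n \<in> set C"
    proof -
      have "n \<in> set xs" using set_xs(1) t(2) by simp
      moreover have "n \<notin> set (take t xs)" using t by simp
      moreover have "set xs = set (take t xs) \<union> set C"
        unfolding C_def by (metis append_take_drop_id set_append)
      ultimately show ?thesis by blast
    qed
    ultimately have "subseq [1, b, c, n] xs" "1 < c" "c < b" "b < n"
      using bc s t unfolding eq
      by (auto simp: subseq4_append subseq3_append subseq2_append subseq_singleton_left)
    then show False using av unfolding avoids_1324 by blast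
  qed
  have B: "B = [Suc s..<Suc t]"
  proof (rule sorted_distinct_set_unique[OF \<open>sorted B\<close> dist(2) sorted_upt distinct_upt])
    show "set B = set [Suc s..<Suc t]" unfolding setB set_upt by auto
  qed
  have "take (M - s) B = [Suc s..<Suc M]"
    unfolding B using Mt s(2) by (simp add: take_upt del: upt_Suc)
  moreover have "length A = s" using s(2) Mt t(2) len by (simp add: A_def)
  ultimately have "take M xs = A @ [Suc s..<Suc M]" unfolding eq
    using s(2) Mt B by (simp del: upt_Suc)
  then have "set (take M xs) = {1..s} \<union> {Suc s..<Suc M}"
    using s(3) by (simp add: A_def del: upt_Suc)
  also have "\<dots> = {1..M}" using s(1,2) by auto
  finally show ?thesis .
qed

section \<open>Direct sums\<close>

text \<open>The direct sum of permutations; \<open>m\<close> is meant to be the length of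
  \<open>s\<close>.\<close>

definition dsum :: "nat \<Rightarrow> nat list \<Rightarrow> nat list \<Rightarrow> nat list" where
  "dsum m s t = s @ map ((+) m) t"

lemma dsum_in_permutations:
  assumes "s \<in> permutations_of_set {1..m}" "t \<in> permutations_of_set {1..l}"
  shows "dsum m s t \<in> permutations_of_set {1..m + l}"
proof (rule permutations_of_setI)
  note s = permutations_of_setD[OF assms(1)] and t = permutations_of_setD[OF assms(2)]
  have "set (dsum m s t) = {1..m} \<union> (+) m ` {1..l}"
    unfolding dsum_def set_append set_map s t ..
  also have "\<dots> = {1..m + l}" by auto
  finally show "set (dsum m s t) = {1..m + l}" .
  have "{1..m} \<inter> (+) m ` {1..l} = {}" by auto
  then show "distinct (dsum m s t)"
    unfolding dsum_def distinct_append set_map s(1) t(1) using s(2) t(2)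
    by (auto simp: distinct_map)
qed

lemma num_inv_dsum:
  assumes "set s \<subseteq> {..m}" "0 \<notin> set t"
  shows "num_inv (dsum m s t) = num_inv s + num_inv t"
proof -
  have "x < m + y" if "x \<in> set s" "y \<in> set t" for x y
  proof -
    have "x \<le> m" using that(1) assms(1) by auto
    moreover have "y \<noteq> 0" using that(2) assms(2) by metis
    ultimately show ?thesis by linarith
  qed
  then have "num_inv (dsum m s t) = num_inv s + num_inv (map ((+) m) t)"
    unfolding dsum_def by (intro num_inv_append_less) auto
  then show ?thesis by (simp add: num_inv_map)
qed

text \<open>An entry of \<open>t\<close> completes a 132 in \<open>s\<close> to a 1324, and an entry
  of \<open>s\<close> completes a 213 in \<open>t\<close>; this needs both summands nonempty.
  Conversely, a 1324 has three letters in one summand, as its 3 and 2 cannot be split between them.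
  A 2431 cannot straddle the summands because its last letter is its smallest, and within
  \<open>s\<close> its 243 is already a 132.\<close>

lemma avoids_dsum:
  assumes s: "set s \<subseteq> {..m}" "s \<noteq> []" and t: "0 \<notin> set t" "t \<noteq> []"
  shows "avoids (dsum m s t) [1,3,2,4] \<and> avoids (dsum m s t) [2,4,3,1] \<longleftrightarrow>
    avoids s [1,3,2] \<and> avoids t [2,1,3] \<and> avoids t [2,4,3,1]"
proof -
  define t' where "t' = map ((+) m) t"
  have lt: "x < y" if "x \<in> set s" "y \<in> set t'" for x y
  proof -
    from that(2) obtain z where "z \<in> set t" "y = m + z" by (auto simp: t'_def)
    moreover have "x \<le> m" using that(1) s(1) by auto
    moreover have "z \<noteq> 0" using \<open>z \<in> set t\<close> t(1) by metis
    ultimately show ?thesis by linarith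
  qed
  have t': "avoids t' q \<longleftrightarrow> avoids t q" for q
    unfolding t'_def by (rule avoids_map) simp
  have "avoids (s @ t') [1,3,2,4] \<and> avoids (s @ t') [2,4,3,1] \<longleftrightarrow>
    avoids s [1,3,2] \<and> avoids t' [2,1,3] \<and> avoids t' [2,4,3,1]"
  proof (intro iffI conjI; elim conjE)
    assume av: "avoids (s @ t') [1,3,2,4]" "avoids (s @ t') [2,4,3,1]"
    from t(2) have "t' \<noteq> []" by (simp add: t'_def)
    then have y: "hd t' \<in> set t'" by (rule hd_in_set)
    from s(2) have x: "hd s \<in> set s" by simp
    show "avoids s [1,3,2]"
      unfolding avoids_132
    proof (intro allI impI notI)
      fix a b c assume sub: "subseq [a, b, c] s" and "a < c \<and> c < b"
      moreover have "b < hd t'" using subseq_in_set[OF sub, of b] lt y by simp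
      moreover have "subseq [a, b, c, hd t'] (s @ t')" using sub y by (simp add: subseq4_append)
      ultimately show False using av(1) unfolding avoids_1324 by blast
    qed
    show "avoids t' [2,1,3]"
      unfolding avoids_213
    proof (intro allI impI notI)
      fix a b c assume sub: "subseq [a, b, c] t'" and "b < a \<and> a < c"
      moreover have "hd s < b" using subseq_in_set[OF sub, of b] lt x by simp
      moreover have "subseq [hd s, a, b, c] (s @ t')" using sub x by (simp add: subseq4_append)
      ultimately show False using av(1) unfolding avoids_1324 by blast
    qed
    show "avoids t' [2,4,3,1]" using av(2) by (rule avoids_subseq) (rule subseq_drop_many, rule subseq_order.order_refl)
  next
    assume av: "avoids s [1,3,2]" "avoids t' [2,1,3]" "avoids t' [2,4,3,1]"
    have no132: "\<not> (a < c \<and> c < b)" if "subseq [a, b, c] s" for a b c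
      using av(1) that unfolding avoids_132 by blast
    have no213: "\<not> (b < a \<and> a < c)" if "subseq [a, b, c] t'" for a b c
      using av(2) that unfolding avoids_213 by blast
    show "avoids (s @ t') [1,3,2,4]"
      unfolding avoids_1324
    proof (intro allI impI notI)
      fix a b c d assume sub: "subseq [a, b, c, d] (s @ t')" and abcd: "a < c \<and> c < b \<and> b < d"
      have "\<not> subseq [a, b, c] s" using no132 abcd by blast
      moreover have "\<not> subseq [b, c, d] t'" using no213 abcd by blast
      moreover have "\<not> (subseq [a, b] s \<and> subseq [c, d] t')"
        using subseq_in_set[of "[a, b]" s b] subseq_in_set[of "[c, d]" t' c] lt[of b c] abcd by auto
      moreover have "subseq [a, b, c, d] s \<Longrightarrow> subseq [a, b, c] s"
        by (erule subseq_order.trans[rotated]) simp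
      ultimately show False using sub subseq_Cons'[of a "[b, c, d]" t'] unfolding subseq4_append by blast
    qed
    show "avoids (s @ t') [2,4,3,1]"
      unfolding avoids_2431
    proof (intro allI impI notI)
      fix a b c d assume sub: "subseq [a, b, c, d] (s @ t')" and abcd: "d < a \<and> a < c \<and> c < b"
      have "\<not> subseq [a, b, c] s" using no132 abcd by blast
      moreover have "\<not> subseq [a, b, c, d] t'" using av(3) abcd unfolding avoids_2431 by blast
      moreover have "\<not> (subseq [a, b] s \<and> subseq [c, d] t')"
        using subseq_in_set[of "[a, b]" s b] subseq_in_set[of "[c, d]" t' c] lt[of b c] abcd by auto
      moreover have "\<not> (a \<in> set s \<and> subseq [b, c, d] t')"
        using subseq_in_set[of "[b, c, d]" t' d] lt[of a d] abcd by auto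
      moreover have "subseq [a, b, c, d] s \<Longrightarrow> subseq [a, b, c] s"
        by (erule subseq_order.trans[rotated]) simp
      ultimately show False using sub unfolding subseq4_append by blast
    qed
  qed
  then show ?thesis unfolding t' by (simp only: dsum_def t'_def)
qed

text \<open>Behind a cut at \<open>m\<close> stand exactly the values above \<open>m\<close>, so
  subtracting \<open>m\<close> yields a permutation again.\<close>

lemma dsum_decompose:
  assumes xs: "xs \<in> permutations_of_set {1..m + l}" and cut: "set (take m xs) = {1..m}"
  obtains s t where "s \<in> permutations_of_set {1..m}" "t \<in> permutations_of_set {1..l}"
    "xs = dsum m s t"
proof
  note set_xs = permutations_of_setD[OF xs]
  let ?t = "map (\<lambda>x. x - m) (drop m xs)"
  show "take m xs \<in> permutations_of_set {1..m}"
    using cut set_xs(2) by (intro permutations_of_setI) auto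
  have "set (drop m xs) = set xs - set (take m xs)"
  proof -
    have "set (take m xs) \<inter> set (drop m xs) = {}"
      using set_xs(2) by (metis append_take_drop_id distinct_append)
    moreover have "set xs = set (take m xs) \<union> set (drop m xs)"
      by (metis append_take_drop_id set_append)
    ultimately show ?thesis by blast
  qed
  also have "\<dots> = {m<..m + l}" unfolding cut set_xs(1) by auto
  finally have drop: "set (drop m xs) = {m<..m + l}" .
  show "?t \<in> permutations_of_set {1..l}"
  proof (rule permutations_of_setI)
    have "(\<lambda>x. x - m) ` {m<..m + l} = {1..l}"
      by (rule bij_betw_imp_surj_on[OF bij_betwI[of _ _ _ "(+) m"]]) auto
    then show "set ?t = {1..l}" using drop by simp
    have "inj_on (\<lambda>x. x - m) {m<..m + l}" by (auto simp: inj_on_def)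
    then show "distinct ?t" using set_xs(2) drop by (simp add: distinct_map)
  qed
  have "map ((+) m) ?t = drop m xs"
    unfolding map_map by (rule map_idI) (use drop in auto)
  then show "xs = dsum m (take m xs) ?t" by (simp add: dsum_def)
qed

section \<open>The product formula\<close>

lemma av_eq_sum:
  assumes "2 * k + 2 \<le> n"
  shows "av {[1,3,2,4], [2,4,3,1]} n k =
    (\<Sum>i\<le>k. card (partitions i) * card {p \<in> partitions (k - i). steep p})"
proof -
  \<comment> \<open>\<open>Suc k\<close> is the cut that \<open>split_at_cut\<close> provides. It
    makes both lengths exceed \<open>k\<close>, so both summands are counted by partitions.\<close>
  define m l where "m = Suc k" and "l = n - m"
  have ml: "n = m + l" "0 < m" "0 < l" "k < l" using assms by (auto simp: m_def l_def)
  let ?S = "\<lambda>i. {xs \<in> permutations_of_set {1..m}. num_inv xs = i \<and> avoids xs [1,3,2]}"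
  let ?T = "\<lambda>i. {xs \<in> permutations_of_set {1..l}.
    num_inv xs = i \<and> avoids xs [2,1,3] \<and> avoids xs [2,4,3,1]}"
  let ?A = "{xs \<in> permutations_of_set {1..n}.
    num_inv xs = k \<and> avoids xs [1,3,2,4] \<and> avoids xs [2,4,3,1]}"
  \<comment> \<open>The index \<open>i\<close> distributes the inversions over the summands. It
    equals \<open>num_inv s\<close>, so carrying it along does not harm injectivity.\<close>
  let ?D = "SIGMA i:{..k}. ?S i \<times> ?T (k - i)"
  have S: "set s \<subseteq> {..m}" "s \<noteq> []" if "s \<in> permutations_of_set {1..m}" for s
    using permutations_of_setD(1)[OF that] ml(2) by auto
  have T: "0 \<notin> set t" "t \<noteq> []" if "t \<in> permutations_of_set {1..l}" for t
    using permutations_of_setD(1)[OF that] ml(3) by auto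
  have "bij_betw (\<lambda>(i, s, t). dsum m s t) ?D ?A"
    unfolding bij_betw_def
  proof
    show "inj_on (\<lambda>(i, s, t). dsum m s t) ?D"
    proof (rule inj_onI)
      fix x y assume "x \<in> ?D" "y \<in> ?D"
        and eq: "(\<lambda>(i, s, t). dsum m s t) x = (\<lambda>(i, s, t). dsum m s t) y"
      then obtain s t s' t' where x: "x = (num_inv s, s, t)" "s \<in> permutations_of_set {1..m}"
        and y: "y = (num_inv s', s', t')" "s' \<in> permutations_of_set {1..m}"
        by auto
      then have "s = s' \<and> map ((+) m) t = map ((+) m) t'"
        using eq length_finite_permutations_of_set[OF x(2)] length_finite_permutations_of_set[OF y(2)]
        by (simp add: dsum_def)
      then show "x = y" using x(1) y(1) by (auto simp: inj_map_eq_map)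
    qed
    show "(\<lambda>(i, s, t). dsum m s t) ` ?D = ?A"
    proof (intro equalityI subsetI)
      fix xs assume "xs \<in> (\<lambda>(i, s, t). dsum m s t) ` ?D"
      then obtain i s t where "i \<le> k" "s \<in> ?S i" "t \<in> ?T (k - i)" "xs = dsum m s t" by auto
      then show "xs \<in> ?A"
        using dsum_in_permutations[of s m t l] num_inv_dsum[of s m t] avoids_dsum[of s m t]
          S[of s] T[of t] ml(1) by simp
    next
      fix xs assume xs: "xs \<in> ?A"
      then have "set (take m xs) = {1..m}"
        using assms by (intro split_at_cut[of xs n]) (auto simp: m_def)
      moreover have "xs \<in> permutations_of_set {1..m + l}" using xs ml(1) by simp
      ultimately obtain s t where st: "s \<in> permutations_of_set {1..m}"
        "t \<in> permutations_of_set {1..l}" "xs = dsum m s t"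
        by (metis dsum_decompose)
      then have "num_inv s + num_inv t = k" "avoids s [1,3,2]" "avoids t [2,1,3]" "avoids t [2,4,3,1]"
        using xs num_inv_dsum[of s m t] avoids_dsum[of s m t] S[of s] T[of t] by auto
      then have "(num_inv s, s, t) \<in> ?D" using st by auto
      then show "xs \<in> (\<lambda>(i, s, t). dsum m s t) ` ?D" using st(3) by force
    qed
  qed
  then have "card ?A = card ?D" by (rule bij_betw_same_card[symmetric])
  also have "\<dots> = (\<Sum>i\<le>k. card (?S i) * card (?T (k - i)))"
    by (subst card_SigmaI) (auto simp: card_cartesian_product)
  also have "\<dots> = (\<Sum>i\<le>k. card (partitions i) * card {p \<in> partitions (k - i). steep p})"
    using ml(4) by (intro sum.cong refl arg_cong2[of _ _ _ _ "(*)"])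
      (simp_all add: card_avoids_132_eq_213 card_avoids_213 card_avoids_213_2431 m_def del: One_nat_def)
  finally show ?thesis by (simp add: av_def card_inversions conj_assoc)
qed

theorem proposition5p13:
  "has_limit_sequence {[1,3,2,4], [2,4,3,1]} \<and>
   limit_gf {[1,3,2,4], [2,4,3,1]} = partition_gf * steep_gf"
proof
  let ?B = "{[1,3,2,4], [2,4,3,1]} :: nat list set"
  let ?c = "\<lambda>k. \<Sum>i\<le>k. card (partitions i) * card {p \<in> partitions (k - i). steep p}"
  have ev: "\<forall>n\<ge>2 * k + 2. av ?B n k = ?c k" for k
    using av_eq_sum by blast
  then show "has_limit_sequence ?B" unfolding has_limit_sequence_def by blast
  have "limit_sequence ?B k = ?c k" for k
    unfolding limit_sequence_def
  proof (rule the_equality)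
    show "\<exists>m. \<forall>n\<ge>m. av ?B n k = ?c k" using ev by blast
    fix c assume "\<exists>m. \<forall>n\<ge>m. av ?B n k = c"
    then obtain m where "\<forall>n\<ge>m. av ?B n k = c" by blast
    then have "av ?B (max m (2 * k + 2)) k = c" by simp
    moreover have "av ?B (max m (2 * k + 2)) k = ?c k" using ev[of k] by simp
    ultimately show "c = ?c k" by metis
  qed
  then show "limit_gf ?B = partition_gf * steep_gf"
    by (intro fps_ext)
      (simp add: limit_gf_def partition_gf_def steep_gf_def fps_mult_nth atMost_atLeast0)
qed

end
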